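(* Let $\lambda_0\in\mathbb{R}$. An approximate design $d$ maximizes $\varphi_{g,\lambda_0}$ over all approximate designs for every exchangeable prior distribution $g$ of $\tau_0$ if and only if $\mathrm{tr}(A_d)=ny_0$.
   Context: Fix integers $p\ge2$ (periods), $t\ge2$ (treatments), $n\ge1$ (subjects) and a symmetric positive definite real $p\times p$ matrix $\Sigma$ (within-subject covariance). $1_k$ is the all-ones vector of length $k$, $J_k=1_k1_k'$, $B_k=I_k-J_k/k$, prime denotes transpose, and $\tilde B=\Sigma^{-1}-\Sigma^{-1}J_p\Sigma^{-1}/(1_p'\Sigma^{-1}1_p)$. Let ${\cal S}=\{1,\dots,t\}^p$ be the set of treatment sequences. For $s=(t_1,\dots,t_p)\in{\cal S}$, $T_s$ is the $p\times t$ matrix with $(k,i)$ entry $1$ if $t_k=i$ and $0$ otherwise; $F_s$ is the $p\times t$ matrix with zero first row and, for $k\ge2$, $(k,i)$ entry $1$ if $t_{k-1}=i$ and $0$ otherwise. An (approximate) design $d$ is a vector $P_d=(p_s)_{s\in{\cal S}}$ with $p_s\ge0$, $\sum_sp_s=1$. For $1\le i,j\le2$ put $\hat A_{sij}=B_tG_{s,i}'\tilde BG_{s,j}B_t$ with $G_{s,1}=F_s$, $G_{s,2}=T_s+\lambda_0F_s$; $\hat A_{dij}=n\sum_sp_s\hat A_{sij}$; $A_{dij}=\hat A_{dij}-nG_i'\tilde BG_j$ with $G_1=\sum_sp_sF_sB_t$, $G_2=\sum_sp_s(T_s+\lambda_0F_s)B_t$; and $A_d=A_{d11}-A_{d12}A_{d22}^-A_{d21}$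 ($^-$ denotes a generalized inverse); $A_d$ is nonnegative definite. In the proportional model (carryover effects equal $\lambda$ times direct effects $\tau$), the information for $\lambda$ at $(\tau_0,\lambda_0)$ is $\tau_0'A_d\tau_0$. A prior $g$ is a probability distribution on $\{\tau_0\in\mathbb{R}^t:1_t'\tau_0=0,\ \tau_0\neq0\}$, exchangeable if invariant under all permutations of coordinates, and $\varphi_{g,\lambda_0}(d)=\mathbb{E}_g[\tau_0'A_d\tau_0]\in[0,\infty]$. Let $h_{sij}=\mathrm{tr}(\hat A_{sij})$, $r_s(x)=h_{s11}+2h_{s12}x+h_{s22}x^2$, $r(x)=\max_{s\in{\cal S}}r_s(x)$, and $y_0=\min_{x\in\mathbb{R}}r(x)$. *)

theory Defs
  imports "HOL-Probability.Probability"
begin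

text \<open>
  Periods are the elements of a finite linearly ordered type \<open>'p\<close> (so \<open>p = CARD('p)\<close>),
  treatments the elements of a finite type \<open>'t\<close> (so \<open>t = CARD('t)\<close>). A treatment sequence
  is a function \<open>'p \<Rightarrow> 't\<close>, and a \<open>p \<times> t\<close> matrix has type \<open>real^'t^'p\<close>.
\<close>

definition symmetric_pos_def :: "real^'n^'n \<Rightarrow> bool" where
  "symmetric_pos_def M \<longleftrightarrow> transpose M = M \<and> (\<forall>x. x \<noteq> 0 \<longrightarrow> x \<bullet> (M *v x) > 0)"

definition is_generalized_inverse :: "real^'n^'m \<Rightarrow> real^'m^'n \<Rightarrow> bool" where
  "is_generalized_inverse M X \<longleftrightarrow> M ** X ** M = M"

definition J_mat :: "real^'k^'k" where
  "J_mat = (\<chi> i j. 1)"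

definition B_mat :: "real^'k^'k" where
  "B_mat = mat 1 - (1 / real CARD('k)) *\<^sub>R J_mat"

text \<open>The numeral \<open>1\<close> of type \<open>real^'p\<close> is the all-ones vector.\<close>

definition B_tilde :: "real^'p^'p \<Rightarrow> real^'p^'p" where
  "B_tilde Cov = matrix_inv Cov
     - (1 / ((1 :: real^'p) \<bullet> (matrix_inv Cov *v 1)))
         *\<^sub>R (matrix_inv Cov ** J_mat ** matrix_inv Cov)"

definition T_mat :: "('p::finite \<Rightarrow> 't::finite) \<Rightarrow> real^'t^'p" where
  "T_mat s = (\<chi> k i. if s k = i then 1 else 0)"

text \<open>For a period \<open>k\<close> other than the first, \<open>Max {..<k}\<close> is the preceding period.\<close>

definition F_mat :: "('p::{finite,linorder} \<Rightarrow> 't::finite) \<Rightarrow> real^'t^'p::_" where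
  "F_mat s = (\<chi> k i. if {..<k} \<noteq> {} \<and> s (Max {..<k}) = i then 1 else 0)"

text \<open>The index \<open>i\<close> below is only used for \<open>i \<in> {1, 2}\<close>.\<close>

definition G_seq :: "real \<Rightarrow> nat \<Rightarrow> ('p::{finite,linorder} \<Rightarrow> 't::finite) \<Rightarrow> real^'t^'p::_" where
  "G_seq lam0 i s = (if i = 1 then F_mat s else T_mat s + lam0 *\<^sub>R F_mat s)"

definition A_hat_seq ::
  "real^'p::_^'p::_ \<Rightarrow> real \<Rightarrow> nat \<Rightarrow> nat \<Rightarrow> ('p::{finite,linorder} \<Rightarrow> 't::finite) \<Rightarrow> real^'t^'t" where
  "A_hat_seq Cov lam0 i j s =
     B_mat ** transpose (G_seq lam0 i s) ** B_tilde Cov ** G_seq lam0 j s ** B_mat"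

definition approx_design :: "(('p::finite \<Rightarrow> 't::finite) \<Rightarrow> real) \<Rightarrow> bool" where
  "approx_design d \<longleftrightarrow> (\<forall>s. d s \<ge> 0) \<and> (\<Sum>s\<in>UNIV. d s) = 1"

definition A_hat ::
  "nat \<Rightarrow> real^'p::_^'p::_ \<Rightarrow> real \<Rightarrow> nat \<Rightarrow> nat
     \<Rightarrow> (('p::{finite,linorder} \<Rightarrow> 't::finite) \<Rightarrow> real) \<Rightarrow> real^'t^'t" where
  "A_hat n Cov lam0 i j d = real n *\<^sub>R (\<Sum>s\<in>UNIV. d s *\<^sub>R A_hat_seq Cov lam0 i j s)"

definition G_design ::
  "real \<Rightarrow> nat \<Rightarrow> (('p::{finite,linorder} \<Rightarrow> 't::finite) \<Rightarrow> real) \<Rightarrow> real^'t^'p::_" where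
  "G_design lam0 i d = (\<Sum>s\<in>UNIV. d s *\<^sub>R (G_seq lam0 i s ** B_mat))"

definition A_block ::
  "nat \<Rightarrow> real^'p::_^'p::_ \<Rightarrow> real \<Rightarrow> nat \<Rightarrow> nat
     \<Rightarrow> (('p::{finite,linorder} \<Rightarrow> 't::finite) \<Rightarrow> real) \<Rightarrow> real^'t^'t" where
  "A_block n Cov lam0 i j d = A_hat n Cov lam0 i j d
     - real n *\<^sub>R (transpose (G_design lam0 i d) ** B_tilde Cov ** G_design lam0 j d)"

text \<open>The parameter \<open>ginv\<close> is a choice of generalized inverse for each matrix.\<close>

definition A_info ::
  "(real^'t^'t \<Rightarrow> real^'t^'t) \<Rightarrow> nat \<Rightarrow> real^'p::_^'p::_ \<Rightarrow> real
     \<Rightarrow> (('p::{finite,linorder} \<Rightarrow> 't::finite) \<Rightarrow> real) \<Rightarrow> real^'t^'t" where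
  "A_info ginv n Cov lam0 d = A_block n Cov lam0 1 1 d
     - A_block n Cov lam0 1 2 d ** ginv (A_block n Cov lam0 2 2 d)
         ** A_block n Cov lam0 2 1 d"

definition prior_distribution :: "(real^'t) measure \<Rightarrow> bool" where
  "prior_distribution g \<longleftrightarrow> prob_space g \<and> sets g = sets borel
     \<and> (AE tau in g. (\<Sum>i\<in>UNIV. tau $ i) = 0 \<and> tau \<noteq> 0)"

definition exchangeable :: "(real^'t) measure \<Rightarrow> bool" where
  "exchangeable g \<longleftrightarrow>
     (\<forall>\<pi>. \<pi> permutes UNIV \<longrightarrow> distr g borel (\<lambda>tau. \<chi> i. tau $ \<pi> i) = g)"

text \<open>
  The expectation may be infinite, so it is a nonnegative integral. The matrix \<open>A_info\<close> is
  nonnegative definite for every design, hence \<open>ennreal\<close> does not truncate the integrand.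
\<close>

definition phi ::
  "(real^'t^'t \<Rightarrow> real^'t^'t) \<Rightarrow> nat \<Rightarrow> real^'p::_^'p::_ \<Rightarrow> (real^'t) measure \<Rightarrow> real
     \<Rightarrow> (('p::{finite,linorder} \<Rightarrow> 't::finite) \<Rightarrow> real) \<Rightarrow> ennreal" where
  "phi ginv n Cov g lam0 d =
     (\<integral>\<^sup>+ tau. ennreal (tau \<bullet> (A_info ginv n Cov lam0 d *v tau)) \<partial>g)"

definition h_seq ::
  "real^'p::_^'p::_ \<Rightarrow> real \<Rightarrow> nat \<Rightarrow> nat \<Rightarrow> ('p::{finite,linorder} \<Rightarrow> 't::finite) \<Rightarrow> real" where
  "h_seq Cov lam0 i j s = trace (A_hat_seq Cov lam0 i j s)"

definition r_seq ::
  "real^'p::_^'p::_ \<Rightarrow> real \<Rightarrow> ('p::{finite,linorder} \<Rightarrow> 't::finite) \<Rightarrow> real \<Rightarrow> real" where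
  "r_seq Cov lam0 s x =
     h_seq Cov lam0 1 1 s + 2 * h_seq Cov lam0 1 2 s * x + h_seq Cov lam0 2 2 s * x\<^sup>2"

definition r_max ::
  "'t::finite itself \<Rightarrow> real^'p::{finite,linorder}^'p::_ \<Rightarrow> real \<Rightarrow> real \<Rightarrow> real" where
  "r_max _ Cov lam0 x = (MAX s\<in>(UNIV :: ('p \<Rightarrow> 't) set). r_seq Cov lam0 s x)"

text \<open>
  The least value of \<open>r_max\<close> is attained when \<open>Cov\<close> is positive definite and there are at
  least two periods and two treatments: it is then a maximum of finitely many convex
  quadratics, one of which has a positive leading coefficient.
\<close>

definition y0 :: "'t::finite itself \<Rightarrow> real^'p::{finite,linorder}^'p::_ \<Rightarrow> real \<Rightarrow> real" where
  "y0 t Cov lam0 = (LEAST y. y \<in> range (r_max t Cov lam0))"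

end

theory Submission
  imports Defs
begin

text \<open>
  By the Schur complement, the information \<open>\<tau>' A\<^sub>d \<tau>\<close> is the minimum over \<open>v\<close> of the quadratic
  form of the block matrix \<open>(A\<^sub>d\<^sub>i\<^sub>j)\<close> at \<open>(\<tau>, v)\<close>, which is a weighted covariance. Taking
  \<open>v = x \<tau>\<close>, dropping the mean term and summing over the unit vectors gives \<open>tr A\<^sub>d \<le> n r(x)\<close> for
  every \<open>x\<close>. At the minimizer of \<open>r\<close>, a convex combination of active quadratics \<open>r\<^sub>s\<close> has slope zero;
  averaging these weights over all relabellings of the treatments makes all blocks multiples of
  \<open>B\<^sub>t\<close>, and the bound is attained. Averaging over relabellings also shows that the criterion
  for an exchangeable prior is a constant multiple of \<open>tr A\<^sub>d\<close>, and the constant is positive and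
  finite for the uniform distribution on the centered unit vectors.
\<close>

subsection \<open>Quadratic forms\<close>

lemma inner_congruence:
  fixes X :: "real^'a^'b" and Y :: "real^'c^'e" and M :: "real^'e^'b"
  shows "u \<bullet> ((transpose X ** M ** Y) *v v) = (X *v u) \<bullet> (M *v (Y *v v))"
  by (simp add: dot_lmul_matrix flip: matrix_vector_mul_assoc)
     (metis dot_lmul_matrix inner_commute transpose_matrix_vector transpose_transpose)

lemma inner_mult_symmetric:
  fixes M :: "real^'a^'a"
  assumes "transpose M = M"
  shows "u \<bullet> (M *v v) = v \<bullet> (M *v u)"
  by (metis assms dot_lmul_matrix inner_commute transpose_matrix_vector)

lemma inner_axis_matrix_axis:
  fixes M :: "real^'a^'b"
  shows "axis i 1 \<bullet> (M *v axis j 1) = M $ i $ j"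
  by (simp add: inner_axis' matrix_vector_mult_basis column_def)

lemma trace_eq_sum_inner:
  fixes M :: "real^'a^'a"
  shows "trace M = (\<Sum>i\<in>UNIV. axis i 1 \<bullet> (M *v axis i 1))"
  by (simp add: trace_def inner_axis_matrix_axis)

section \<open>The inverse covariance matrix and \<open>B_tilde\<close>\<close>

lemma symmetric_pos_def_matrix_inv:
  fixes M :: "real^'a^'a"
  assumes "symmetric_pos_def M"
  shows "symmetric_pos_def (matrix_inv M)"
proof -
  have sym: "transpose M = M" and pos: "\<And>x. x \<noteq> 0 \<Longrightarrow> x \<bullet> (M *v x) > 0"
    using assms by (auto simp: symmetric_pos_def_def)
  have "inj ((*v) M)"
    using pos by (subst linear_injective_0) (force simp: matrix_vector_mul_linear)+
  then have "invertible M"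
    by (simp add: invertible_left_inverse matrix_left_invertible_injective)
  then have MI: "M ** matrix_inv M = mat 1"
    unfolding invertible_def matrix_inv_def by (rule someI2_ex) simp
  have "transpose (matrix_inv M) ** M = mat 1"
    by (metis MI matrix_transpose_mul sym transpose_mat)
  then have "transpose (matrix_inv M) = matrix_inv M"
    by (metis MI matrix_mul_assoc matrix_mul_lid matrix_mul_rid)
  moreover have "x \<bullet> (matrix_inv M *v x) > 0" if "x \<noteq> 0" for x
  proof -
    \<comment> \<open>With \<open>y = matrix_inv M *v x\<close>, the form of the inverse at
      \<open>x\<close> equals the form of \<open>M\<close> at \<open>y\<close>.\<close>
    have x: "x = M *v (matrix_inv M *v x)"
      by (simp add: MI matrix_vector_mul_assoc)
    with that have "matrix_inv M *v x \<noteq> 0"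
      by (metis matrix_vector_mult_0_right)
    from pos[OF this] show ?thesis
      using x by (metis inner_commute)
  qed
  ultimately show ?thesis by (simp add: symmetric_pos_def_def)
qed

lemma J_mat_mult: "J_mat *v v = (1 \<bullet> v) *\<^sub>R 1"
  by (simp add: vec_eq_iff J_mat_def matrix_vector_mult_def inner_vec_def)

lemma inner_J_congruence:
  fixes S :: "real^'a^'a"
  assumes "transpose S = S"
  shows "u \<bullet> ((S ** J_mat ** S) *v v) = (1 \<bullet> (S *v u)) * (1 \<bullet> (S *v v))"
proof -
  have "u \<bullet> ((S ** J_mat ** S) *v v) = (S *v u) \<bullet> (J_mat *v (S *v v))"
    using inner_congruence[of u S J_mat S v] assms by simp
  also have "\<dots> = (1 \<bullet> (S *v u)) * (1 \<bullet> (S *v v))"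
    by (simp add: J_mat_mult inner_commute)
  finally show ?thesis .
qed

lemma inner_B_tilde:
  fixes C :: "real^'p^'p"
  assumes "symmetric_pos_def C"
  defines "S \<equiv> matrix_inv C"
  shows "u \<bullet> (B_tilde C *v v) =
    u \<bullet> (S *v v) - (1 \<bullet> (S *v u)) * (1 \<bullet> (S *v v)) / (1 \<bullet> (S *v 1))"
proof -
  have "transpose S = S"
    using symmetric_pos_def_matrix_inv[OF assms(1)] by (simp add: S_def symmetric_pos_def_def)
  then show ?thesis
    by (simp add: B_tilde_def S_def[symmetric] matrix_vector_mult_diff_rdistrib inner_diff_right
        scaleR_matrix_vector_assoc[symmetric] inner_J_congruence)
qed

lemma transpose_B_tilde:
  fixes C :: "real^'p^'p"
  assumes "symmetric_pos_def C"
  shows "transpose (B_tilde C) = B_tilde C"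
proof -
  have *: "transpose (matrix_inv C) = matrix_inv C"
    using symmetric_pos_def_matrix_inv[OF assms] by (simp add: symmetric_pos_def_def)
  have "(u :: real^'p) \<bullet> (B_tilde C *v v) = v \<bullet> (B_tilde C *v u)" for u v
    using inner_mult_symmetric[OF *] by (simp add: inner_B_tilde[OF assms] mult.commute)
  then have "B_tilde C $ i $ j = B_tilde C $ j $ i" for i j
    by (metis inner_axis_matrix_axis)
  then show ?thesis
    by (simp add: transpose_def vec_eq_iff)
qed

text \<open>With \<open>S\<close> the inverse covariance, the form at \<open>v\<close> is the
  squared \<open>S\<close>-length of the residual of \<open>v\<close> after
  \<open>S\<close>-orthogonal projection onto the all-ones vector; \<open>b / a\<close> is the
  projection coefficient.\<close>

lemma B_tilde_nonneg:
  fixes C :: "real^'p^'p"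
  assumes "symmetric_pos_def C"
  shows "0 \<le> v \<bullet> (B_tilde C *v v)"
proof -
  define S where "S = matrix_inv C"
  have sym: "transpose S = S" and pos: "\<And>x. x \<noteq> 0 \<Longrightarrow> x \<bullet> (S *v x) > 0"
    using symmetric_pos_def_matrix_inv[OF assms] by (auto simp: S_def symmetric_pos_def_def)
  define a where "a = 1 \<bullet> (S *v 1)"
  define b where "b = 1 \<bullet> (S *v v)"
  have a: "a > 0" using pos[of 1] by (simp add: a_def)
  have nn: "x \<bullet> (S *v x) \<ge> 0" for x using pos[of x] by (cases "x = 0") auto
  have vb: "v \<bullet> (S *v 1) = b" using inner_mult_symmetric[OF sym] by (simp add: b_def)
  have "0 \<le> (v - (b / a) *\<^sub>R 1) \<bullet> (S *v (v - (b / a) *\<^sub>R 1))" by (rule nn)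
  also have "\<dots> = v \<bullet> (S *v v) - 2 * (b / a) * b + (b / a)\<^sup>2 * a"
    by (simp add: matrix_vector_mult_diff_distrib matrix_vector_mult_scaleR inner_diff_left inner_diff_right
        vb flip: a_def b_def) (simp add: power2_eq_square algebra_simps)
  also have "\<dots> = v \<bullet> (S *v v) - b * b / a"
    using a by (simp add: power2_eq_square field_simps)
  finally show ?thesis by (simp add: inner_B_tilde[OF assms] S_def[symmetric] a_def b_def)
qed

subsection \<open>Minimax for finitely many quadratics\<close>

lemma continuous_on_Max_finite:
  fixes f :: "'i \<Rightarrow> 'a::topological_space \<Rightarrow> real"
  assumes "finite I" "I \<noteq> {}" "\<And>i. i \<in> I \<Longrightarrow> continuous_on S (f i)"
  shows "continuous_on S (\<lambda>x. MAX i\<in>I. f i x)"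
  using assms
  by (induction rule: finite_ne_induct) (auto intro!: continuous_intros)

lemma linear_nonneg_imp_coeff_0:
  fixes a b :: real
  assumes "\<And>x. a + b * x \<ge> 0"
  shows "b = 0"
proof (rule ccontr)
  assume "b \<noteq> 0"
  with assms[of "- (a + 1) / b"] show False by simp
qed

text \<open>Either all leading coefficients vanish, and nonnegativity then makes every function
  constant, or one quadratic is coercive and confines the search to a compact interval.\<close>

lemma Max_quadratics_attains_min:
  fixes a b c :: "'i \<Rightarrow> real"
  assumes fin: "finite I" and ne: "I \<noteq> {}"
    and c: "\<And>i. i \<in> I \<Longrightarrow> c i \<ge> 0"
    and nn: "\<And>i x. i \<in> I \<Longrightarrow> a i + 2 * b i * x + c i * x\<^sup>2 \<ge> 0"
  obtains x0 where "\<And>x. (MAX i\<in>I. a i + 2 * b i * x0 + c i * x0\<^sup>2) \<le> (MAX i\<in>I. a i + 2 * b i * x + c i * x\<^sup>2)"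
proof -
  define q where "q i x = a i + 2 * b i * x + c i * x\<^sup>2" for i x
  define R where "R x = (MAX i\<in>I. q i x)" for x
  have q_le: "q i x \<le> R x" if "i \<in> I" for i x
    using that fin by (auto simp: R_def)
  have "\<exists>x0. \<forall>x. R x0 \<le> R x"
  proof (cases "\<forall>i\<in>I. c i = 0")
    case True
    then have "b i = 0" if "i \<in> I" for i
      using linear_nonneg_imp_coeff_0[of "a i" "2 * b i"] nn that by auto
    then have "R x = R 0" for x
      unfolding R_def q_def using True by (intro arg_cong[of _ _ Max] image_cong) auto
    then show ?thesis by (metis order_refl)
  next
    case False
    then obtain j where j: "j \<in> I" "c j > 0" using c by force
    \<comment> \<open>Beyond \<open>K\<close> the quadratic \<open>q j\<close> alone already reaches
      \<open>R 0\<close>. The lower bound 1 on \<open>K\<close> allows the estimate to be multiplied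
      by \<open>\<bar>x\<bar>\<close>.\<close>
    define K where "K = max 1 ((2 * \<bar>b j\<bar> + R 0) / c j)"
    have "R 0 \<ge> 0" using nn[OF j(1), of 0] q_le[OF j(1), of 0] by (simp add: q_def)
    have outside: "R 0 \<le> R x" if "\<bar>x\<bar> \<ge> K" for x
    proof -
      have "c j * \<bar>x\<bar> - 2 * \<bar>b j\<bar> \<ge> R 0"
        using that j by (simp add: K_def field_simps)
      then have "R 0 \<le> \<bar>x\<bar> * (c j * \<bar>x\<bar> - 2 * \<bar>b j\<bar>)"
        using that \<open>R 0 \<ge> 0\<close> mult_mono[of 1 "\<bar>x\<bar>" "R 0"] by (simp add: K_def)
      also have "\<dots> = - 2 * \<bar>b j * x\<bar> + c j * x\<^sup>2"
        by (simp add: power2_eq_square abs_mult algebra_simps)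
      also have "\<dots> \<le> q j x"
        using nn[OF j(1), of 0] by (simp add: q_def)
      also have "\<dots> \<le> R x" by (rule q_le[OF j(1)])
      finally show ?thesis .
    qed
    have "continuous_on {-K..K} R"
      unfolding R_def q_def using fin ne
      by (intro continuous_on_Max_finite) (auto intro!: continuous_intros)
    moreover have "K \<ge> 1" by (simp add: K_def)
    ultimately obtain x0 where x0: "x0 \<in> {-K..K}" "\<And>x. x \<in> {-K..K} \<Longrightarrow> R x0 \<le> R x"
      using continuous_attains_inf[of "{-K..K}" R] by auto
    have "R x0 \<le> R 0" using \<open>K \<ge> 1\<close> by (intro x0(2)) auto
    then have "R x0 \<le> R x" for x
      using outside[of x] x0(2)[of x] by (cases "\<bar>x\<bar> \<ge> K") (auto simp: abs_if split: if_splits)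
    then show ?thesis by blast
  qed
  then show thesis using that by (auto simp: R_def q_def)
qed

text \<open>If all active quadratics had slopes of the same sign at the minimizer of the maximum,
  a small step against that sign would decrease the maximum.\<close>

lemma Max_quadratics_min_active_slope:
  fixes a b c :: "'i \<Rightarrow> real" and e :: real
  assumes fin: "finite I" and ne: "I \<noteq> {}"
    and min: "\<And>x. (MAX i\<in>I. a i + 2 * b i * x0 + c i * x0\<^sup>2) \<le> (MAX i\<in>I. a i + 2 * b i * x + c i * x\<^sup>2)"
    and e: "e\<^sup>2 = 1"
  obtains j where "j \<in> I" "a j + 2 * b j * x0 + c j * x0\<^sup>2 = (MAX i\<in>I. a i + 2 * b i * x0 + c i * x0\<^sup>2)"
    "e * (b j + c j * x0) \<ge> 0"
proof (rule ccontr)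
  assume contra: "\<not> thesis"
  note witness = that
  define q where "q i x = a i + 2 * b i * x + c i * x\<^sup>2" for i x
  define R where "R x = (MAX i\<in>I. q i x)" for x
  have "eventually (\<lambda>h. q i (x0 + e * h) < R x0) (at_right 0)" if i: "i \<in> I" for i
  proof (cases "q i x0 = R x0")
    case True
    \<comment> \<open>This is half the slope of \<open>q i\<close> at \<open>x0\<close> in direction
      \<open>e\<close>; for an active \<open>i\<close> the negated claim makes it negative.\<close>
    define D where "D = e * (b i + c i * x0)"
    have D: "D < 0"
      using contra witness[of i] i True by (force simp: q_def R_def D_def)
    have "((\<lambda>h. 2 * D + c i * h) \<longlongrightarrow> 2 * D + c i * 0) (at_right 0)"
      by (intro tendsto_intros)
    then have "eventually (\<lambda>h. 2 * D + c i * h < 0) (at_right 0)"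
      using D order_tendstoD(2)[of _ "2 * D + c i * 0" _ 0] by simp
    with eventually_at_right_less[of 0] show ?thesis
    proof eventually_elim
      case (elim h)
      have "q i (x0 + e * h) = q i x0 + 2 * D * h + c i * (e\<^sup>2 * h\<^sup>2)"
        by (simp add: q_def D_def power2_eq_square algebra_simps)
      also have "\<dots> = R x0 + h * (2 * D + c i * h)"
        using True e by (simp add: power2_eq_square algebra_simps)
      also have "\<dots> < R x0" using elim by (simp add: mult_pos_neg)
      finally show ?case .
    qed
  next
    case False
    \<comment> \<open>An inactive quadratic stays below the maximum near \<open>x0\<close> by
      continuity.\<close>
    then have "q i x0 < R x0"
      using i fin by (simp add: R_def order.not_eq_order_implies_strict)
    moreover have "((\<lambda>h. q i (x0 + e * h)) \<longlongrightarrow> q i (x0 + e * 0)) (at_right 0)"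
      unfolding q_def by (intro tendsto_intros)
    ultimately show ?thesis by (intro order_tendstoD) auto
  qed
  \<comment> \<open>Finiteness of \<open>I\<close> gives one step \<open>h\<close> that works for
    all quadratics at once.\<close>
  then have "eventually (\<lambda>h. \<forall>i\<in>I. q i (x0 + e * h) < R x0) (at_right 0)"
    using fin by (simp add: eventually_ball_finite)
  then obtain h where "\<forall>i\<in>I. q i (x0 + e * h) < R x0"
    using eventually_happens trivial_limit_at_right_real by blast
  then have "R (x0 + e * h) < R x0"
    using fin ne by (simp add: R_def)
  with min[of "x0 + e * h"] show False by (simp add: R_def q_def)
qed

text \<open>At the minimizer one active quadratic has slope \<ge> 0 and one has slope \<le> 0. A
  mixture of these two has slope zero, and its value is the maximum because both are active.\<close>

lemma Max_quadratics_minimax: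
  fixes a b c :: "'i::finite \<Rightarrow> real"
  assumes c: "\<And>i. c i \<ge> 0"
    and nn: "\<And>i x. a i + 2 * b i * x + c i * x\<^sup>2 \<ge> 0"
  obtains x0 w where
    "\<And>x. (MAX i. a i + 2 * b i * x0 + c i * x0\<^sup>2) \<le> (MAX i. a i + 2 * b i * x + c i * x\<^sup>2)"
    "\<And>i. w i \<ge> 0" "(\<Sum>i\<in>UNIV. w i) = 1"
    "(\<Sum>i\<in>UNIV. w i * b i) + (\<Sum>i\<in>UNIV. w i * c i) * x0 = 0"
    "(\<Sum>i\<in>UNIV. w i * (a i + 2 * b i * x0 + c i * x0\<^sup>2)) = (MAX i. a i + 2 * b i * x0 + c i * x0\<^sup>2)"
proof -
  obtain x0 where min: "\<And>x. (MAX i. a i + 2 * b i * x0 + c i * x0\<^sup>2) \<le> (MAX i. a i + 2 * b i * x + c i * x\<^sup>2)"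
    by (rule Max_quadratics_attains_min[of UNIV c a b]) (use assms in auto)
  define q where "q i = a i + 2 * b i * x0 + c i * x0\<^sup>2" for i
  define D where "D i = b i + c i * x0" for i
  obtain j where j: "q j = (MAX i. q i)" "D j \<ge> 0"
    by (rule Max_quadratics_min_active_slope[of UNIV a b x0 c 1]) (use min in \<open>auto simp: q_def D_def\<close>)
  obtain k where k: "q k = (MAX i. q i)" "D k \<le> 0"
    by (rule Max_quadratics_min_active_slope[of UNIV a b x0 c "-1"]) (use min in \<open>auto simp: q_def D_def\<close>)
  \<comment> \<open>This solves \<open>\<theta> * D j + (1 - \<theta>) * D k = 0\<close>. If the
    slopes agree, their opposite signs force both to be zero, and 1 serves as a default.\<close>
  define \<theta> where "\<theta> = (if D j = D k then 1 else D k / (D k - D j))"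
  have \<theta>: "0 \<le> \<theta>" "\<theta> \<le> 1" "\<theta> * D j + (1 - \<theta>) * D k = 0"
    using j k by (auto simp: \<theta>_def field_simps)
  \<comment> \<open>Adding two indicator terms covers the case \<open>j = k\<close> as well.\<close>
  define w where "w i = (if i = j then \<theta> else 0) + (if i = k then 1 - \<theta> else 0)" for i
  have sum_w: "(\<Sum>i\<in>UNIV. w i * f i) = \<theta> * f j + (1 - \<theta>) * f k" for f :: "'i \<Rightarrow> real"
    by (simp add: w_def distrib_right sum.distrib if_distrib[of "\<lambda>x. x * _"] cong: if_cong)
  show thesis
  proof
    show "w i \<ge> 0" for i using \<theta> by (simp add: w_def)
    show "(\<Sum>i\<in>UNIV. w i) = 1" using sum_w[of "\<lambda>_. 1"] by simp
    show "(\<Sum>i\<in>UNIV. w i * b i) + (\<Sum>i\<in>UNIV. w i * c i) * x0 = 0"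
      using sum_w[of D] \<theta>(3) by (simp add: D_def sum.distrib sum_distrib_right distrib_left mult.assoc)
    show "(\<Sum>i\<in>UNIV. w i * (a i + 2 * b i * x0 + c i * x0\<^sup>2)) = (MAX i. a i + 2 * b i * x0 + c i * x0\<^sup>2)"
      using sum_w[of q] j(1) k(1) unfolding q_def[symmetric] by (simp add: algebra_simps)
  qed (rule min)
qed

subsection \<open>Permutation averages\<close>

text \<open>Double transitivity of the permutations; it makes the off-diagonal entries of an
  invariant matrix comparable.\<close>

lemma permutation_mapping_pair:
  assumes "i \<noteq> j" "k \<noteq> l"
  obtains \<pi> where "\<pi> permutes UNIV" "\<pi> i = k" "\<pi> j = l"
proof
  define \<sigma> where "\<sigma> = Transposition.transpose i k"
  \<comment> \<open>The second swap leaves \<open>k\<close> in place, since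
    \<open>k = \<sigma> i\<close> differs from both \<open>l\<close> and
    \<open>\<sigma> j\<close>.\<close>
  show "Transposition.transpose l (\<sigma> j) \<circ> \<sigma> permutes UNIV"
    unfolding \<sigma>_def by (intro permutes_compose permutes_swap_id) auto
  show "(Transposition.transpose l (\<sigma> j) \<circ> \<sigma>) i = k" "(Transposition.transpose l (\<sigma> j) \<circ> \<sigma>) j = l"
    using assms by (auto simp: \<sigma>_def Transposition.transpose_def)
qed

lemma transpose_B_mat: "transpose B_mat = B_mat"
  by (simp add: B_mat_def J_mat_def mat_def Finite_Cartesian_Product.transpose_def vec_eq_iff)

lemma B_mat_nth: "(B_mat :: real^'t^'t) $ i $ j = (if i = j then 1 else 0) - 1 / real CARD('t)"
  by (simp add: B_mat_def J_mat_def mat_def)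

lemma B_mat_mult: "(B_mat :: real^'t^'t) *v v = v - ((\<Sum>i\<in>UNIV. v $ i) / real CARD('t)) *\<^sub>R 1"
  by (simp add: vec_eq_iff matrix_vector_mult_def B_mat_nth left_diff_distrib sum_subtractf
      sum_divide_distrib if_distrib[of "\<lambda>x. x * _"] cong: if_cong)

lemma B_mat_one: "(B_mat :: real^'t^'t) *v 1 = 0"
  by (simp add: B_mat_mult)

lemma trace_B_mat: "trace (B_mat :: real^'t^'t) = real CARD('t) - 1"
  by (simp add: trace_def B_mat_nth sum_subtractf right_diff_distrib)

lemma trace_scaleR: "trace (c *\<^sub>R (M :: real^'n^'n)) = c * trace M"
  by (simp add: trace_def sum_distrib_left)

text \<open>A permutation invariant matrix is a combination of the identity and the all-ones
  matrix; vanishing row sums leave only the multiples of \<^term>\<open>B_mat\<close>.\<close>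

lemma permutation_invariant_eq_B_mat:
  fixes M :: "real^'t^'t"
  assumes card: "CARD('t) \<ge> 2"
    and inv: "\<And>\<pi> i j. \<pi> permutes UNIV \<Longrightarrow> M $ \<pi> i $ \<pi> j = M $ i $ j"
    and zero: "M *v 1 = 0"
  shows "M = (trace M / (real CARD('t) - 1)) *\<^sub>R B_mat"
proof -
  define t where "t = real CARD('t)"
  have t: "t > 1" using card by (simp add: t_def)
  define i0 where "i0 = (SOME i :: 't. True)"
  define \<alpha> where "\<alpha> = M $ i0 $ i0"
  have diag: "M $ i $ i = \<alpha>" for i
    using inv[of "Transposition.transpose i i0" i i] by (simp add: permutes_swap_id \<alpha>_def)
  then have tr: "trace M = t * \<alpha>" by (simp add: trace_def t_def)
  have offdiag: "M $ i $ j = - \<alpha> / (t - 1)" if "i \<noteq> j" for i j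
  proof -
    \<comment> \<open>Permutations fixing \<open>i\<close> show that the off-diagonal entries of row
      \<open>i\<close> agree; the zero row sum then determines them.\<close>
    have "M $ i $ k = M $ i $ j" if "k \<noteq> i" for k
      by (rule permutation_mapping_pair[of i j i k]) (use \<open>i \<noteq> j\<close> that inv in metis)+
    then have "(\<Sum>k\<in>UNIV - {i}. M $ i $ k) = (t - 1) * M $ i $ j"
      using card by (simp add: t_def card_Diff_singleton of_nat_diff)
    moreover have "(\<Sum>k\<in>UNIV. M $ i $ k) = 0"
      using zero by (simp add: vec_eq_iff matrix_vector_mult_def)
    ultimately have "\<alpha> + (t - 1) * M $ i $ j = 0"
      using sum.remove[of UNIV i "\<lambda>k. M $ i $ k"] diag by simp
    then show ?thesis using t by (simp add: field_simps)
  qed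
  show ?thesis
    using t diag offdiag
    by (simp add: vec_eq_iff B_mat_nth tr t_def[symmetric]) (simp add: field_simps)
qed

text \<open>The sum \<open>S\<close> of the outer products of all permuted copies of
  \<open>\<tau>\<close> is permutation invariant with zero row sums, hence a multiple of
  \<open>B_mat\<close>. The sum of the forms is the entrywise pairing of \<open>A\<close> with
  \<open>S\<close>.\<close>

lemma sum_permuted_quadratic_form:
  fixes A :: "real^'t^'t" and \<tau> :: "real^'t"
  assumes card: "CARD('t) \<ge> 2" and A: "A *v 1 = 0" and \<tau>: "(\<Sum>i\<in>UNIV. \<tau> $ i) = 0"
  shows "(\<Sum>\<pi> | \<pi> permutes UNIV. (\<chi> i. \<tau> $ \<pi> i) \<bullet> (A *v (\<chi> i. \<tau> $ \<pi> i)))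
    = trace A * (fact CARD('t) / (real CARD('t) - 1) * (\<tau> \<bullet> \<tau>))"
proof -
  define P where "P = {\<pi> :: 't \<Rightarrow> 't. \<pi> permutes UNIV}"
  have fin: "finite P" by (simp add: P_def finite_permutations)
  define S :: "real^'t^'t" where "S = (\<chi> i j. \<Sum>\<pi>\<in>P. \<tau> $ \<pi> i * \<tau> $ \<pi> j)"
  have total: "(\<Sum>i\<in>UNIV. f (\<pi> i)) = (\<Sum>i\<in>UNIV. f i)" if "\<pi> \<in> P" for f :: "'t \<Rightarrow> real" and \<pi>
    using that sum.permute[of \<pi> UNIV f] by (simp add: P_def comp_def)
  have trS: "trace S = fact CARD('t) * (\<tau> \<bullet> \<tau>)"
  proof -
    have "trace S = (\<Sum>\<pi>\<in>P. \<Sum>i\<in>UNIV. \<tau> $ \<pi> i * \<tau> $ \<pi> i)"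
      unfolding trace_def S_def by (subst sum.swap) simp
    also have "\<dots> = (\<Sum>\<pi>\<in>P. \<tau> \<bullet> \<tau>)"
      by (simp add: total[of _ "\<lambda>i. \<tau> $ i * \<tau> $ i"] inner_vec_def)
    also have "\<dots> = fact CARD('t) * (\<tau> \<bullet> \<tau>)"
      by (simp add: P_def card_permutations[OF refl])
    finally show ?thesis .
  qed
  have S: "S = (trace S / (real CARD('t) - 1)) *\<^sub>R B_mat"
  proof (rule permutation_invariant_eq_B_mat[OF card])
    fix \<sigma> :: "'t \<Rightarrow> 't" and i j assume \<sigma>: "\<sigma> permutes UNIV"
    show "S $ \<sigma> i $ \<sigma> j = S $ i $ j"
      using sum_permutations_compose_right[OF \<sigma>, of "\<lambda>\<pi>. \<tau> $ \<pi> i * \<tau> $ \<pi> j"]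
      by (simp add: S_def P_def)
  next
    have "(\<Sum>j\<in>UNIV. \<Sum>\<pi>\<in>P. \<tau> $ \<pi> i * \<tau> $ \<pi> j) = 0" for i
      by (subst sum.swap) (simp add: total \<tau> flip: sum_distrib_left)
    then show "S *v 1 = 0"
      by (simp add: vec_eq_iff matrix_vector_mult_def S_def)
  qed
  define \<gamma> where "\<gamma> = trace S / (real CARD('t) - 1)"
  have "(\<Sum>\<pi>\<in>P. (\<chi> i. \<tau> $ \<pi> i) \<bullet> (A *v (\<chi> i. \<tau> $ \<pi> i)))
      = (\<Sum>\<pi>\<in>P. \<Sum>i\<in>UNIV. \<Sum>j\<in>UNIV. A $ i $ j * (\<tau> $ \<pi> i * \<tau> $ \<pi> j))"
    by (simp add: inner_vec_def matrix_vector_mult_def sum_distrib_left mult_ac)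
  also have "\<dots> = (\<Sum>i\<in>UNIV. \<Sum>j\<in>UNIV. A $ i $ j * S $ i $ j)"
    unfolding S_def by (subst sum.swap, rule sum.cong[OF refl], subst sum.swap) (simp add: sum_distrib_left)
  also have "\<dots> = (\<Sum>i\<in>UNIV. \<Sum>j\<in>UNIV. A $ i $ j * (\<gamma> * B_mat $ i $ j))"
    by (subst S) (simp add: \<gamma>_def)
  \<comment> \<open>The identity part of \<open>B_mat\<close> yields the trace; the all-ones part
    yields the sum of all entries of \<open>A\<close>, which is zero.\<close>
  also have "\<dots> = \<gamma> * (trace A - (\<Sum>i\<in>UNIV. (A *v 1) $ i) / real CARD('t))"
    by (simp add: B_mat_nth trace_def matrix_vector_mult_def algebra_simps sum_subtractf
        sum_distrib_left sum_divide_distrib if_distrib[of "\<lambda>x. _ * x"] cong: if_cong)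
  finally show ?thesis
    by (simp add: A P_def \<gamma>_def trS)
qed

subsection \<open>The information matrix\<close>

lemma transpose_zero_matrix: "transpose (0 :: real^'n^'m) = 0"
  by (simp add: Finite_Cartesian_Product.transpose_def vec_eq_iff)

lemma sum_scaleR_matrix_vector_mult:
  fixes M :: "'s \<Rightarrow> real^'n^'m"
  shows "(\<Sum>s\<in>S. c s *\<^sub>R M s) *v v = (\<Sum>s\<in>S. c s *\<^sub>R (M s *v v))"
  by (induction S rule: infinite_finite_induct)
     (simp_all add: matrix_vector_mult_add_rdistrib scaleR_matrix_vector_assoc)

lemma matrix_vector_mult_sum_scaleR:
  fixes M :: "real^'n^'m"
  shows "M *v (\<Sum>s\<in>S. c s *\<^sub>R x s) = (\<Sum>s\<in>S. c s *\<^sub>R (M *v x s))"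
  by (induction S rule: infinite_finite_induct)
     (simp_all add: matrix_vector_right_distrib matrix_vector_mult_scaleR)

text \<open>Mean of squares minus square of the mean is the variance, here for the form of
  \<open>Q\<close>; it exposes the sign once that form is nonnegative.\<close>

lemma weighted_variance_quadratic_form:
  fixes Q :: "real^'p^'p" and H :: "'s \<Rightarrow> real^'p"
  assumes Q: "transpose Q = Q" and d: "(\<Sum>s\<in>S. d s) = 1"
  defines "m \<equiv> \<Sum>s\<in>S. d s *\<^sub>R H s"
  shows "(\<Sum>s\<in>S. d s * (H s \<bullet> (Q *v H s))) - m \<bullet> (Q *v m)
    = (\<Sum>s\<in>S. d s * ((H s - m) \<bullet> (Q *v (H s - m))))"
proof -
  have mm: "m \<bullet> (Q *v m) = (\<Sum>s\<in>S. d s * (m \<bullet> (Q *v H s)))"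
    by (subst (2) m_def) (simp add: matrix_vector_mult_sum_scaleR inner_sum_right)
  have "(\<Sum>s\<in>S. d s * ((H s - m) \<bullet> (Q *v (H s - m))))
      = (\<Sum>s\<in>S. d s * (H s \<bullet> (Q *v H s)) - 2 * (d s * (m \<bullet> (Q *v H s))) + d s * (m \<bullet> (Q *v m)))"
    using inner_mult_symmetric[OF Q, of "H _" m]
    by (intro sum.cong) (simp_all add: matrix_vector_mult_diff_distrib inner_diff_left inner_diff_right algebra_simps)
  also have "\<dots> = (\<Sum>s\<in>S. d s * (H s \<bullet> (Q *v H s)))
      - 2 * (\<Sum>s\<in>S. d s * (m \<bullet> (Q *v H s))) + (\<Sum>s\<in>S. d s) * (m \<bullet> (Q *v m))"
    by (simp add: sum.distrib sum_subtractf sum_distrib_left sum_distrib_right)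
  also have "\<dots> = (\<Sum>s\<in>S. d s * (H s \<bullet> (Q *v H s))) - 2 * (m \<bullet> (Q *v m)) + m \<bullet> (Q *v m)"
    by (simp add: d flip: mm)
  finally show ?thesis by simp
qed

text \<open>Completing the square in \<open>v\<close>. With a mere generalized inverse this requires
  \<open>A21 *v u\<close> to lie in the range of \<open>A22\<close>, which nonnegativity of the
  block form enforces.\<close>

lemma schur_complement_quadratic_form:
  fixes A11 A12 A21 A22 X :: "real^'n^'n"
  assumes sym: "transpose A22 = A22" and X: "is_generalized_inverse A22 X"
    and A12: "\<And>u v. u \<bullet> (A12 *v v) = v \<bullet> (A21 *v u)"
    and nn: "\<And>u v. 0 \<le> u \<bullet> (A11 *v u) + 2 * (v \<bullet> (A21 *v u)) + v \<bullet> (A22 *v v)"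
  shows "u \<bullet> (A11 *v u) + 2 * (v \<bullet> (A21 *v u)) + v \<bullet> (A22 *v v)
    = u \<bullet> ((A11 - A12 ** X ** A21) *v u)
      + (v + X *v (A21 *v u)) \<bullet> (A22 *v (v + X *v (A21 *v u)))"
proof -
  define b where "b = A21 *v u"
  \<comment> \<open>\<open>N\<close> annihilates the range of \<open>A22\<close>, and
    \<open>N *v b = 0\<close> says that \<open>b\<close> equals
    \<open>A22 *v (X *v b)\<close>.\<close>
  define N where "N = mat 1 - A22 ** X"
  have "N ** A22 = mat 1 ** A22 - A22 ** X ** A22"
    by (simp add: N_def matrix_matrix_mult_def vec_eq_iff left_diff_distrib sum_subtractf)
  then have "N ** A22 = 0"
    using X by (simp add: is_generalized_inverse_def)
  then have AN: "A22 ** transpose N = 0"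
    by (metis matrix_transpose_mul sym transpose_zero_matrix)
  have "N *v b = 0"
  proof -
    \<comment> \<open>\<open>w\<close> lies in the kernel of \<open>A22\<close>, so along its
      multiples the block form is affine. Being bounded below, it has slope zero, and that slope is
      twice the squared length of \<open>N *v b\<close>.\<close>
    define w where "w = transpose N *v (N *v b)"
    have Aw: "A22 *v w = 0"
      using matrix_vector_mul_assoc[of A22 "transpose N" "N *v b"] by (simp add: w_def AN)
    have "0 \<le> u \<bullet> (A11 *v u) + 2 * (w \<bullet> b) * c" for c
      using nn[of u "c *\<^sub>R w"] by (simp add: matrix_vector_mult_scaleR Aw b_def algebra_simps)
    then have "w \<bullet> b = 0"
      using linear_nonneg_imp_coeff_0 by fastforce
    also have "w \<bullet> b = (N *v b) \<bullet> (N *v b)"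
      by (metis w_def dot_lmul_matrix transpose_matrix_vector)
    finally show ?thesis by simp
  qed
  then have AXb: "A22 *v (X *v b) = b"
    by (simp add: N_def matrix_vector_mult_diff_rdistrib matrix_vector_mul_assoc)
  have "u \<bullet> ((A12 ** X ** A21) *v u) = (X *v b) \<bullet> b"
    by (simp add: b_def A12 flip: matrix_vector_mul_assoc)
  moreover have "(v + X *v b) \<bullet> (A22 *v (v + X *v b))
      = v \<bullet> (A22 *v v) + 2 * (v \<bullet> b) + (X *v b) \<bullet> b"
    using inner_mult_symmetric[OF sym, of "X *v b" v]
    by (simp add: matrix_vector_right_distrib AXb inner_add_left inner_add_right)
  ultimately show ?thesis
    by (simp add: b_def matrix_vector_mult_diff_rdistrib inner_diff_right)
qed

section \<open>Blocks of a design as weighted covariances\<close>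

definition centered_G ::
  "real \<Rightarrow> nat \<Rightarrow> ('p::{finite,linorder} \<Rightarrow> 't::finite) \<Rightarrow> real^'t^'p::_" where
  "centered_G lam0 i s = G_seq lam0 i s ** B_mat"

text \<open>Absorbing the outer centering factors into \<open>centered_G\<close> leaves a congruence
  of \<open>B_tilde\<close>, to which \<open>inner_congruence\<close> applies.\<close>

lemma A_hat_seq_eq:
  "A_hat_seq Cov lam0 i j s = transpose (centered_G lam0 i s) ** B_tilde Cov ** centered_G lam0 j s"
  by (simp add: A_hat_seq_def centered_G_def matrix_transpose_mul transpose_B_mat matrix_mul_assoc)

lemma G_design_eq: "G_design lam0 i d = (\<Sum>s\<in>UNIV. d s *\<^sub>R centered_G lam0 i s)"
  by (simp add: G_design_def centered_G_def)

lemma centered_G_one: "centered_G lam0 i s *v 1 = 0"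
  by (simp add: centered_G_def B_mat_one flip: matrix_vector_mul_assoc)

lemma inner_A_block:
  "u \<bullet> (A_block n Cov lam0 i j d *v v) =
    n * ((\<Sum>s\<in>UNIV. d s * ((centered_G lam0 i s *v u) \<bullet> (B_tilde Cov *v (centered_G lam0 j s *v v))))
      - (G_design lam0 i d *v u) \<bullet> (B_tilde Cov *v (G_design lam0 j d *v v)))"
  by (simp add: A_block_def A_hat_def matrix_vector_mult_diff_rdistrib inner_diff_right
      sum_scaleR_matrix_vector_mult A_hat_seq_eq inner_congruence inner_sum_right right_diff_distrib
      flip: scaleR_matrix_vector_assoc)

lemma A_block_one: "A_block n Cov lam0 i j d *v 1 = 0"
proof -
  have "u \<bullet> (A_block n Cov lam0 i j d *v 1) = 0" for u
    by (simp add: inner_A_block G_design_eq sum_scaleR_matrix_vector_mult centered_G_one)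
  then show ?thesis using inner_eq_zero_iff by blast
qed

lemma A_info_one: "A_info ginv n Cov lam0 d *v 1 = 0"
  by (simp add: A_info_def matrix_vector_mult_diff_rdistrib A_block_one flip: matrix_vector_mul_assoc)

lemma inner_A_block_swap:
  assumes "symmetric_pos_def Cov"
  shows "u \<bullet> (A_block n Cov lam0 i j d *v v) = v \<bullet> (A_block n Cov lam0 j i d *v u)"
  unfolding inner_A_block
  by (simp only: inner_mult_symmetric[OF transpose_B_tilde[OF assms], of "_ *v u"])

lemma transpose_A_block:
  assumes "symmetric_pos_def Cov"
  shows "transpose (A_block n Cov lam0 i j d) = A_block n Cov lam0 j i d"
  using inner_A_block_swap[OF assms, of "axis _ 1" _ _ i j d "axis _ 1"]
  by (simp add: Finite_Cartesian_Product.transpose_def vec_eq_iff inner_axis_matrix_axis)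

text \<open>By bilinearity the three blocks combine into one weighted variance, that of the vectors
  \<open>H u v s\<close> under the weights \<open>d\<close>.\<close>

lemma A_block_quadratic_form:
  fixes Cov :: "real^'p::{finite,linorder}^'p::_" and d :: "('p \<Rightarrow> 't::finite) \<Rightarrow> real" and lam0 :: real and n :: nat
  assumes Cov: "symmetric_pos_def Cov"
  defines "H \<equiv> \<lambda>u v s. centered_G lam0 1 s *v u + centered_G lam0 2 s *v v"
  defines "m \<equiv> \<lambda>u v. \<Sum>s\<in>UNIV. d s *\<^sub>R H u v s"
  shows "u \<bullet> (A_block n Cov lam0 1 1 d *v u) + 2 * (v \<bullet> (A_block n Cov lam0 2 1 d *v u))
      + v \<bullet> (A_block n Cov lam0 2 2 d *v v)
    = n * ((\<Sum>s\<in>UNIV. d s * (H u v s \<bullet> (B_tilde Cov *v H u v s))) - m u v \<bullet> (B_tilde Cov *v m u v))"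
proof -
  define Q where "Q = B_tilde Cov"
  have Q: "x \<bullet> (Q *v y) = y \<bullet> (Q *v x)" for x y
    using inner_mult_symmetric[OF transpose_B_tilde[OF Cov]] by (simp add: Q_def)
  have expand: "(x + y) \<bullet> (Q *v (x + y)) = x \<bullet> (Q *v x) + 2 * (y \<bullet> (Q *v x)) + y \<bullet> (Q *v y)" for x y
    using Q[of x y] by (simp add: matrix_vector_right_distrib inner_add_left inner_add_right)
  have m: "m u v = G_design lam0 1 d *v u + G_design lam0 2 d *v v"
    by (simp add: m_def H_def G_design_eq sum_scaleR_matrix_vector_mult scaleR_right_distrib sum.distrib)
  show ?thesis
    unfolding m inner_A_block H_def Q_def[symmetric] expand
    by (simp add: distrib_left sum.distrib sum_distrib_left algebra_simps)
qed

text \<open>The lower bound is nonnegativity of a variance; the upper bound drops the mean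
  term.\<close>

lemma A_block_quadratic_form_bounds:
  fixes Cov :: "real^'p::{finite,linorder}^'p::_" and d :: "('p \<Rightarrow> 't::finite) \<Rightarrow> real" and lam0 :: real and n :: nat
  assumes Cov: "symmetric_pos_def Cov" and d: "approx_design d"
  defines "H \<equiv> \<lambda>u v s. centered_G lam0 1 s *v u + centered_G lam0 2 s *v v"
  defines "q \<equiv> \<lambda>u v. u \<bullet> (A_block n Cov lam0 1 1 d *v u) + 2 * (v \<bullet> (A_block n Cov lam0 2 1 d *v u))
      + v \<bullet> (A_block n Cov lam0 2 2 d *v v)"
  shows "0 \<le> q u v"
    and "q u v \<le> n * (\<Sum>s\<in>UNIV. d s * (H u v s \<bullet> (B_tilde Cov *v H u v s)))"
proof -
  have "0 \<le> n * (\<Sum>s\<in>UNIV. d s * ((H u v s - m) \<bullet> (B_tilde Cov *v (H u v s - m))))" for m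
    using d by (auto intro!: mult_nonneg_nonneg sum_nonneg B_tilde_nonneg[OF Cov] simp: approx_design_def)
  then show "0 \<le> q u v"
    using weighted_variance_quadratic_form[OF transpose_B_tilde[OF Cov], of d UNIV "H u v"] d
    unfolding q_def A_block_quadratic_form[OF Cov] H_def approx_design_def by simp
  show "q u v \<le> n * (\<Sum>s\<in>UNIV. d s * (H u v s \<bullet> (B_tilde Cov *v H u v s)))"
    unfolding q_def A_block_quadratic_form[OF Cov] H_def
    by (intro mult_left_mono) (simp_all add: B_tilde_nonneg[OF Cov])
qed

lemma A_info_quadratic_form:
  fixes Cov :: "real^'p::{finite,linorder}^'p::_" and d :: "('p \<Rightarrow> 't::finite) \<Rightarrow> real" and lam0 :: real and n :: nat
  assumes Cov: "symmetric_pos_def Cov" and d: "approx_design d"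
    and ginv: "\<And>M. is_generalized_inverse M (ginv M)"
  shows A_info_nonneg: "0 \<le> u \<bullet> (A_info ginv n Cov lam0 d *v u)"
    and A_info_le: "u \<bullet> (A_info ginv n Cov lam0 d *v u) \<le>
      n * (\<Sum>s\<in>UNIV. d s * ((centered_G lam0 1 s *v u + centered_G lam0 2 s *v v)
        \<bullet> (B_tilde Cov *v (centered_G lam0 1 s *v u + centered_G lam0 2 s *v v))))"
proof -
  note bounds = A_block_quadratic_form_bounds[OF Cov d, where n = n and ?lam0.0 = lam0]
  note schur = schur_complement_quadratic_form[OF transpose_A_block[OF Cov] ginv
      inner_A_block_swap[OF Cov] bounds(1), folded A_info_def]
  \<comment> \<open>\<open>- w\<close> is the minimizing second argument: there the square in the
    Schur identity vanishes. Any other \<open>v\<close> adds a nonnegative term and so gives an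
    upper bound.\<close>
  define w where "w = ginv (A_block n Cov lam0 2 2 d) *v (A_block n Cov lam0 2 1 d *v u)"
  show "0 \<le> u \<bullet> (A_info ginv n Cov lam0 d *v u)"
    using schur[of u "- w"] bounds(1)[of u "- w"] by (simp add: w_def)
  have "0 \<le> x \<bullet> (A_block n Cov lam0 2 2 d *v x)" for x
    using bounds(1)[of 0 x] by simp
  from this[of "v + w"] show "u \<bullet> (A_info ginv n Cov lam0 d *v u) \<le>
      n * (\<Sum>s\<in>UNIV. d s * ((centered_G lam0 1 s *v u + centered_G lam0 2 s *v v)
        \<bullet> (B_tilde Cov *v (centered_G lam0 1 s *v u + centered_G lam0 2 s *v v))))"
    using schur[of u v] bounds(2)[of u v] by (simp add: w_def)
qed

subsection \<open>The maximal trace\<close>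

lemma scaleR_matrix_mult:
  fixes M :: "real^'n^'m" and N :: "real^'k^'n"
  shows "(c *\<^sub>R M) ** N = c *\<^sub>R (M ** N)" "M ** (c *\<^sub>R N) = c *\<^sub>R (M ** N)"
  by (simp_all add: matrix_matrix_mult_def vec_eq_iff sum_distrib_left mult_ac)

section \<open>Relabelling the treatments\<close>

lemma sum_permutes_apply: "\<pi> permutes S \<Longrightarrow> (\<Sum>x\<in>S. f (\<pi> x)) = (\<Sum>x\<in>S. f x)"
  using sum.permute[of \<pi> S f] by (simp add: comp_def)

lemma mult_B_mat_nth:
  fixes M :: "real^'t^'p"
  shows "(M ** B_mat) $ k $ j = M $ k $ j - (\<Sum>l\<in>UNIV. M $ k $ l) / real CARD('t)"
  by (simp add: matrix_matrix_mult_def B_mat_nth right_diff_distrib sum_subtractf sum_divide_distrib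
      if_distrib[of "\<lambda>x. _ * x"] cong: if_cong)

text \<open>Relabelling by \<open>\<sigma>\<close> moves column \<open>j\<close> to column
  \<open>\<sigma> j\<close>, and centering respects this because it only subtracts row
  means.\<close>

lemma centered_G_permute:
  assumes "\<sigma> permutes UNIV"
  shows "centered_G lam0 i (\<sigma> \<circ> s) $ k $ \<sigma> j = centered_G lam0 i s $ k $ j"
proof -
  have G: "G_seq lam0 i (\<sigma> \<circ> s) $ k $ \<sigma> l = G_seq lam0 i s $ k $ l" for l
    using permutes_inj[OF assms] by (simp add: G_seq_def T_mat_def F_mat_def inj_eq)
  show ?thesis
    using sum_permutes_apply[OF assms, of "\<lambda>l. G_seq lam0 i (\<sigma> \<circ> s) $ k $ l"]
    by (simp add: centered_G_def mult_B_mat_nth G)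
qed

lemma A_hat_seq_permute:
  assumes "\<sigma> permutes UNIV"
  shows "A_hat_seq Cov lam0 i j (\<sigma> \<circ> s) $ \<sigma> a $ \<sigma> b = A_hat_seq Cov lam0 i j s $ a $ b"
proof -
  have "column (\<sigma> a) (centered_G lam0 i (\<sigma> \<circ> s)) = column a (centered_G lam0 i s)" for i a
    by (simp add: column_def vec_eq_iff centered_G_permute[OF assms])
  then show ?thesis
    unfolding inner_axis_matrix_axis[symmetric] A_hat_seq_eq inner_congruence
    by (simp add: matrix_vector_mult_basis)
qed

lemma h_seq_permute:
  assumes "\<sigma> permutes UNIV"
  shows "h_seq Cov lam0 i j (\<sigma> \<circ> s) = h_seq Cov lam0 i j s"
  using sum_permutes_apply[OF assms, of "\<lambda>a. A_hat_seq Cov lam0 i j (\<sigma> \<circ> s) $ a $ a"]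
  by (simp add: h_seq_def trace_def A_hat_seq_permute[OF assms])

lemma sum_permute_values:
  fixes f :: "('p::finite \<Rightarrow> 't::finite) \<Rightarrow> 'b::comm_monoid_add"
  assumes "\<sigma> permutes UNIV"
  shows "(\<Sum>s\<in>UNIV. f (\<sigma> \<circ> s)) = (\<Sum>s\<in>UNIV. f s)"
  using permutes_inv_o[OF assms]
  by (intro sum.reindex_bij_witness[of _ "\<lambda>s. inv \<sigma> \<circ> s" "\<lambda>s. \<sigma> \<circ> s"]) (simp_all add: o_assoc)

section \<open>Designs invariant under relabelling\<close>

definition symmetric_design :: "(('p::finite \<Rightarrow> 't::finite) \<Rightarrow> real) \<Rightarrow> bool" where
  "symmetric_design d \<longleftrightarrow> (\<forall>\<sigma> s. \<sigma> permutes UNIV \<longrightarrow> d (\<sigma> \<circ> s) = d s)"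

lemma trace_A_hat:
  "trace (A_hat n Cov lam0 i j d) = n * (\<Sum>s\<in>UNIV. d s * h_seq Cov lam0 i j s)"
proof -
  have "trace (A_hat n Cov lam0 i j d) = n * (\<Sum>a\<in>UNIV. \<Sum>s\<in>UNIV. d s * A_hat_seq Cov lam0 i j s $ a $ a)"
    by (simp add: trace_def A_hat_def flip: sum_distrib_left)
  also have "(\<Sum>a\<in>UNIV. \<Sum>s\<in>UNIV. d s * A_hat_seq Cov lam0 i j s $ a $ a) = (\<Sum>s\<in>UNIV. d s * h_seq Cov lam0 i j s)"
    by (subst sum.swap) (simp add: h_seq_def trace_def sum_distrib_left)
  finally show ?thesis .
qed

lemma symmetric_design_A_hat:
  fixes d :: "('p::{finite,linorder} \<Rightarrow> 't::finite) \<Rightarrow> real"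
  assumes card: "CARD('t) \<ge> 2" and sym: "symmetric_design d"
  shows "A_hat n Cov lam0 i j d =
    (n * (\<Sum>s\<in>UNIV. d s * h_seq Cov lam0 i j s) / (real CARD('t) - 1)) *\<^sub>R B_mat"
  unfolding trace_A_hat[symmetric]
proof (rule permutation_invariant_eq_B_mat[OF card])
  fix \<sigma> :: "'t \<Rightarrow> 't" and a b assume \<sigma>: "\<sigma> permutes UNIV"
  show "A_hat n Cov lam0 i j d $ \<sigma> a $ \<sigma> b = A_hat n Cov lam0 i j d $ a $ b"
    using sum_permute_values[OF \<sigma>, of "\<lambda>s. d s * A_hat_seq Cov lam0 i j s $ \<sigma> a $ \<sigma> b"] sym \<sigma>
    by (simp add: A_hat_def A_hat_seq_permute[OF \<sigma>] symmetric_design_def)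
next
  show "A_hat n Cov lam0 i j d *v 1 = 0"
    by (simp add: A_hat_def A_hat_seq_eq sum_scaleR_matrix_vector_mult centered_G_one
        flip: scaleR_matrix_vector_assoc matrix_vector_mul_assoc)
qed

text \<open>Invariance makes all columns equal, and the zero row sums then make them vanish. Hence
  the mean term of each block disappears.\<close>

lemma symmetric_design_G_design:
  fixes d :: "('p::{finite,linorder} \<Rightarrow> 't::finite) \<Rightarrow> real"
  assumes sym: "symmetric_design d"
  shows "G_design lam0 i d = 0"
proof -
  define K where "K = G_design lam0 i d"
  have inv: "K $ k $ \<sigma> j = K $ k $ j" if \<sigma>: "\<sigma> permutes UNIV" for \<sigma> k j
    using sum_permute_values[OF \<sigma>, of "\<lambda>s. d s * centered_G lam0 i s $ k $ \<sigma> j"] sym \<sigma>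
    by (simp add: K_def G_design_eq centered_G_permute[OF \<sigma>] symmetric_design_def)
  have "K *v 1 = 0"
    by (simp add: K_def G_design_eq sum_scaleR_matrix_vector_mult centered_G_one)
  then have row: "(\<Sum>l\<in>UNIV. K $ k $ l) = 0" for k
    by (simp add: vec_eq_iff matrix_vector_mult_def)
  have "K $ k $ j = 0" for k j
  proof -
    have "K $ k $ l = K $ k $ j" for l
      using inv[of "Transposition.transpose j l" k j] by (simp add: permutes_swap_id)
    then have "(\<Sum>l\<in>UNIV. K $ k $ l) = (\<Sum>l\<in>(UNIV :: 't set). K $ k $ j)"
      by (intro sum.cong refl)
    then show ?thesis using row[of k] by simp
  qed
  then show ?thesis by (simp add: K_def vec_eq_iff)
qed

lemma symmetric_design_A_block:
  fixes d :: "('p::{finite,linorder} \<Rightarrow> 't::finite) \<Rightarrow> real"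
  assumes "CARD('t) \<ge> 2" and "symmetric_design d"
  shows "A_block n Cov lam0 i j d =
    (n * (\<Sum>s\<in>UNIV. d s * h_seq Cov lam0 i j s) / (real CARD('t) - 1)) *\<^sub>R B_mat"
  using assms
  by (simp add: A_block_def symmetric_design_A_hat symmetric_design_G_design)

lemma h_seq_swap:
  assumes "symmetric_pos_def Cov"
  shows "h_seq Cov lam0 i j s = h_seq Cov lam0 j i s"
  unfolding h_seq_def trace_eq_sum_inner A_hat_seq_eq inner_congruence
  by (intro sum.cong refl inner_mult_symmetric transpose_B_tilde assms)

text \<open>All blocks are multiples of \<open>B_mat\<close>, so the Schur complement is essentially
  the scalar \<open>h11 - h12^2 / h22\<close>. The hypothesis on \<open>x\<close> says that
  \<open>x\<close> is stationary for the averaged quadratic, whose value there is this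
  scalar.\<close>

lemma trace_A_info_symmetric_design:
  fixes d :: "('p::{finite,linorder} \<Rightarrow> 't::finite) \<Rightarrow> real"
  assumes card: "CARD('t) \<ge> 2" and Cov: "symmetric_pos_def Cov"
    and ginv: "\<And>M. is_generalized_inverse M (ginv M)"
    and sym: "symmetric_design d"
    and x: "(\<Sum>s\<in>UNIV. d s * h_seq Cov lam0 1 2 s) + (\<Sum>s\<in>UNIV. d s * h_seq Cov lam0 2 2 s) * x = 0"
  shows "trace (A_info ginv n Cov lam0 d) = n * (\<Sum>s\<in>UNIV. d s * r_seq Cov lam0 s x)"
proof -
  define t1 where "t1 = real CARD('t) - 1"
  have t1: "t1 > 0" using card by (simp add: t1_def)
  define h where "h i j = (\<Sum>s\<in>UNIV. d s * h_seq Cov lam0 i j s)" for i j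
  have block: "A_block n Cov lam0 i j d = (n * h i j / t1) *\<^sub>R B_mat" for i j
    using symmetric_design_A_block[OF card sym] by (simp add: h_def t1_def)
  have h21: "h 2 1 = h 1 2" by (simp only: h_def h_seq_swap[OF Cov, of _ 2 1])
  have h12: "h 1 2 = - h 2 2 * x" using x by (simp add: h_def)
  define X where "X = ginv (A_block n Cov lam0 2 2 d)"
  have tr: "trace (A_info ginv n Cov lam0 d) = n * h 1 1 - (n * h 1 2 / t1)\<^sup>2 * trace (B_mat ** X ** B_mat)"
    using t1 by (simp add: A_info_def block X_def[symmetric, unfolded block] h21 trace_sub trace_scaleR trace_B_mat
        scaleR_matrix_mult power2_eq_square del: One_nat_def flip: t1_def)
  \<comment> \<open>If \<open>n * h 2 2\<close> vanishes, stationarity forces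
    \<open>n * h 1 2\<close> to vanish too, so both sides are zero.\<close>
  have "(n * h 1 2 / t1)\<^sup>2 * trace (B_mat ** X ** B_mat) = n * h 2 2 * x\<^sup>2"
  proof (cases "n * h 2 2 = 0")
    case True
    then show ?thesis by (auto simp: h12 simp del: One_nat_def)
  next
    case False
    define \<gamma> where "\<gamma> = n * h 2 2 / t1"
    have \<gamma>: "\<gamma> \<noteq> 0" using False t1 by (simp add: \<gamma>_def)
    \<comment> \<open>The defining equation of a generalized inverse of
      \<open>\<gamma> *\<^sub>R B_mat\<close> determines \<open>B_mat ** X ** B_mat\<close>,
      whichever \<open>X\<close> is chosen.\<close>
    have "\<gamma> *\<^sub>R (\<gamma> *\<^sub>R (B_mat ** X ** B_mat)) = \<gamma> *\<^sub>R B_mat"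
      using ginv[of "\<gamma> *\<^sub>R B_mat"]
      by (simp add: is_generalized_inverse_def scaleR_matrix_mult X_def block \<gamma>_def)
    then have "\<gamma> * trace (B_mat ** X ** B_mat) = t1"
      using \<gamma> by (metis real_vector.scale_left_imp_eq trace_scaleR trace_B_mat t1_def)
    then have "trace (B_mat ** X ** B_mat) = t1 / \<gamma>"
      using \<gamma> by (simp add: field_simps)
    then show ?thesis
      using False t1 by (simp add: \<gamma>_def h12 power2_eq_square del: One_nat_def)
  qed
  moreover have "(\<Sum>s\<in>UNIV. d s * r_seq Cov lam0 s x) = h 1 1 + 2 * h 1 2 * x + h 2 2 * x\<^sup>2"
    by (simp add: r_seq_def h_def distrib_left sum.distrib sum_distrib_left sum_distrib_right mult_ac)
  then have "(\<Sum>s\<in>UNIV. d s * r_seq Cov lam0 s x) = h 1 1 - h 2 2 * x\<^sup>2"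
    by (simp add: h12 power2_eq_square del: One_nat_def)
  ultimately show ?thesis
    by (simp add: tr right_diff_distrib mult.assoc del: One_nat_def)
qed

section \<open>Averaging weights over relabellings\<close>

definition symmetrize :: "(('p::finite \<Rightarrow> 't::finite) \<Rightarrow> real) \<Rightarrow> ('p \<Rightarrow> 't) \<Rightarrow> real" where
  "symmetrize w s = (\<Sum>\<pi> | \<pi> permutes UNIV. w (\<pi> \<circ> s)) / fact CARD('t)"

lemma symmetric_design_symmetrize: "symmetric_design (symmetrize w)"
  unfolding symmetric_design_def
proof (intro allI impI)
  fix \<sigma> :: "'b \<Rightarrow> 'b" and s :: "'a \<Rightarrow> 'b"
  assume "\<sigma> permutes UNIV"
  then show "symmetrize w (\<sigma> \<circ> s) = symmetrize w s"
    using sum_permutations_compose_right[of \<sigma> UNIV "\<lambda>\<pi>. w (\<pi> \<circ> s)"]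
    by (simp add: symmetrize_def o_assoc)
qed

text \<open>For each fixed \<open>\<pi>\<close>, reindexing the sequences by \<open>\<pi>\<close>
  moves the relabelling from \<open>w\<close> onto \<open>f\<close>, which absorbs it.\<close>

lemma sum_symmetrize:
  fixes w f :: "('p::finite \<Rightarrow> 't::finite) \<Rightarrow> real"
  assumes f: "\<And>\<sigma> s. \<sigma> permutes UNIV \<Longrightarrow> f (\<sigma> \<circ> s) = f s"
  shows "(\<Sum>s\<in>UNIV. symmetrize w s * f s) = (\<Sum>s\<in>UNIV. w s * f s)"
proof -
  have "(\<Sum>s\<in>UNIV. \<Sum>\<pi> | \<pi> permutes UNIV. w (\<pi> \<circ> s) * f s)
      = (\<Sum>\<pi> | \<pi> permutes (UNIV :: 't set). \<Sum>s\<in>UNIV. w (\<pi> \<circ> s) * f (\<pi> \<circ> s))"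
    by (subst sum.swap) (simp add: f)
  also have "\<dots> = (\<Sum>\<pi> | \<pi> permutes (UNIV :: 't set). \<Sum>s\<in>UNIV. w s * f s)"
    by (rule sum.cong[OF refl], rule sum_permute_values[where f = "\<lambda>s. w s * f s"]) simp
  also have "\<dots> = fact CARD('t) * (\<Sum>s\<in>UNIV. w s * f s)"
    by (simp add: card_permutations[OF refl])
  finally show ?thesis
    by (simp add: symmetrize_def sum_distrib_right flip: sum_divide_distrib)
qed

lemma approx_design_symmetrize:
  assumes "approx_design w"
  shows "approx_design (symmetrize w)"
  using assms sum_symmetrize[of "\<lambda>_. 1" w]
  by (auto simp: approx_design_def symmetrize_def intro!: divide_nonneg_nonneg sum_nonneg)

section \<open>The upper bound for the trace and its attainment\<close>

text \<open>Expanding each trace over the unit vectors \<open>u\<close> shows \<open>r_seq\<close>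
  as the total of the forms at the pairs \<open>(u, x u)\<close>, matching the bound
  \<open>A_info_le\<close> with \<open>v = x u\<close>.\<close>

lemma r_seq_eq_sum:
  fixes Cov :: "real^'p::{finite,linorder}^'p::_" and s :: "'p \<Rightarrow> 't::finite"
  assumes "symmetric_pos_def Cov"
  shows "r_seq Cov lam0 s x = (\<Sum>i\<in>UNIV.
    (centered_G lam0 1 s *v axis i 1 + centered_G lam0 2 s *v (x *\<^sub>R axis i 1))
      \<bullet> (B_tilde Cov *v (centered_G lam0 1 s *v axis i 1 + centered_G lam0 2 s *v (x *\<^sub>R axis i 1))))"
proof -
  have h: "h_seq Cov lam0 i j s = (\<Sum>a\<in>UNIV. (centered_G lam0 i s *v axis a 1)
      \<bullet> (B_tilde Cov *v (centered_G lam0 j s *v axis a 1)))" for i j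
    by (simp add: h_seq_def trace_eq_sum_inner A_hat_seq_eq inner_congruence)
  show ?thesis
    using inner_mult_symmetric[OF transpose_B_tilde[OF assms], of "centered_G lam0 2 s *v axis _ 1" "centered_G lam0 1 s *v axis _ 1"]
    unfolding r_seq_def h
    by (simp add: matrix_vector_right_distrib inner_add_left inner_add_right matrix_vector_mult_scaleR
        sum.distrib sum_distrib_left power2_eq_square algebra_simps)
qed

lemma r_seq_nonneg:
  assumes "symmetric_pos_def Cov"
  shows "0 \<le> r_seq Cov lam0 s x"
  unfolding r_seq_eq_sum[OF assms] by (intro sum_nonneg B_tilde_nonneg[OF assms])

lemma h_seq_nonneg:
  assumes "symmetric_pos_def Cov"
  shows "0 \<le> h_seq Cov lam0 i i s"
  unfolding h_seq_def trace_eq_sum_inner A_hat_seq_eq inner_congruence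
  by (intro sum_nonneg B_tilde_nonneg[OF assms])

text \<open>Summing \<open>A_info_le\<close> over the unit vectors bounds the trace by a weighted
  mean of the \<open>r_seq\<close> values, which is at most their maximum.\<close>

lemma trace_A_info_le_r_max:
  fixes Cov :: "real^'p::{finite,linorder}^'p::_" and d :: "('p \<Rightarrow> 't::finite) \<Rightarrow> real"
  assumes Cov: "symmetric_pos_def Cov" and d: "approx_design d"
    and ginv: "\<And>M. is_generalized_inverse M (ginv M)"
  shows "trace (A_info ginv n Cov lam0 d) \<le> n * r_max TYPE('t) Cov lam0 x"
proof -
  have "trace (A_info ginv n Cov lam0 d) \<le> n * (\<Sum>s\<in>UNIV. d s * r_seq Cov lam0 s x)"
    unfolding trace_eq_sum_inner r_seq_eq_sum[OF Cov]
    by (rule order_trans[OF sum_mono[OF A_info_le[OF Cov d ginv]]],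
        simp only: sum_distrib_left, subst sum.swap, rule order_refl)
  also have "(\<Sum>s\<in>UNIV. d s * r_seq Cov lam0 s x) \<le> (\<Sum>s\<in>UNIV. d s * r_max TYPE('t) Cov lam0 x)"
    using d by (intro sum_mono mult_left_mono) (auto simp: r_max_def approx_design_def)
  also have "\<dots> = r_max TYPE('t) Cov lam0 x"
    using d by (simp add: approx_design_def flip: sum_distrib_right)
  finally show ?thesis by (simp add: mult_left_mono)
qed

lemma trace_A_info_max:
  fixes Cov :: "real^'p::{finite,linorder}^'p::_" and lam0 :: real
    and ginv :: "real^'t::finite^'t \<Rightarrow> real^'t^'t"
  assumes card: "CARD('t) \<ge> 2" and Cov: "symmetric_pos_def Cov"
    and ginv: "\<And>M. is_generalized_inverse M (ginv M)"
  shows trace_A_info_le_y0: "\<And>d :: ('p \<Rightarrow> 't) \<Rightarrow> real. approx_design d \<Longrightarrow>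
        trace (A_info ginv n Cov lam0 d) \<le> n * y0 TYPE('t) Cov lam0"
    and trace_A_info_attains_y0: "\<exists>d :: ('p \<Rightarrow> 't) \<Rightarrow> real. approx_design d \<and>
        trace (A_info ginv n Cov lam0 d) = n * y0 TYPE('t) Cov lam0"
proof -
  have "0 \<le> h_seq Cov lam0 1 1 s + 2 * h_seq Cov lam0 1 2 s * x + h_seq Cov lam0 2 2 s * x\<^sup>2"
    for s :: "'p \<Rightarrow> 't" and x
    using r_seq_nonneg[OF Cov] by (simp add: r_seq_def)
  note minimax = Max_quadratics_minimax[of "h_seq Cov lam0 2 2", OF h_seq_nonneg[OF Cov] this, folded r_seq_def]
  obtain x0 and w :: "('p \<Rightarrow> 't) \<Rightarrow> real" where
    min: "\<And>x. (MAX s. r_seq Cov lam0 (s :: 'p \<Rightarrow> 't) x0) \<le> (MAX s. r_seq Cov lam0 (s :: 'p \<Rightarrow> 't) x)"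
    and w: "\<And>s. w s \<ge> 0" "(\<Sum>s\<in>UNIV. w s) = 1"
      "(\<Sum>s\<in>UNIV. w s * h_seq Cov lam0 1 2 s) + (\<Sum>s\<in>UNIV. w s * h_seq Cov lam0 2 2 s) * x0 = 0"
      "(\<Sum>s\<in>UNIV. w s * r_seq Cov lam0 s x0) = (MAX s. r_seq Cov lam0 (s :: 'p \<Rightarrow> 't) x0)"
    by (rule minimax) (rule that, assumption+)
  \<comment> \<open>Since the minimum is attained at \<open>x0\<close>, the \<open>LEAST\<close>
    operator denotes it.\<close>
  have y0: "y0 TYPE('t) Cov lam0 = r_max TYPE('t) Cov lam0 x0"
    unfolding y0_def using min by (intro Least_equality) (auto simp: r_max_def)
  show "trace (A_info ginv n Cov lam0 d) \<le> n * y0 TYPE('t) Cov lam0"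
    if "approx_design d" for d :: "('p \<Rightarrow> 't) \<Rightarrow> real"
    unfolding y0 by (rule trace_A_info_le_r_max[OF Cov that ginv])
  \<comment> \<open>Invariance of \<open>h_seq\<close> and \<open>r_seq\<close> lets the averaged
    weights inherit the zero slope and the value from \<open>w\<close>.\<close>
  have "r_seq Cov lam0 (\<sigma> \<circ> s) x0 = r_seq Cov lam0 s x0" if "\<sigma> permutes UNIV" for \<sigma> and s :: "'p \<Rightarrow> 't"
    using that by (simp add: r_seq_def h_seq_permute)
  then have "trace (A_info ginv n Cov lam0 (symmetrize w)) = n * y0 TYPE('t) Cov lam0"
    using w(3,4)
    by (subst trace_A_info_symmetric_design[OF card Cov ginv symmetric_design_symmetrize, of _ _ x0])
       (simp_all add: sum_symmetrize h_seq_permute y0 r_max_def)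
  moreover have "approx_design (symmetrize w)"
    using w by (intro approx_design_symmetrize) (simp add: approx_design_def)
  ultimately show "\<exists>d :: ('p \<Rightarrow> 't) \<Rightarrow> real. approx_design d \<and>
        trace (A_info ginv n Cov lam0 d) = n * y0 TYPE('t) Cov lam0"
    by blast
qed

subsection \<open>Exchangeable priors\<close>

lemma measurable_permute_coordinates [measurable]:
  "(\<lambda>\<tau>::real^'t. \<chi> i. \<tau> $ \<pi> i) \<in> borel_measurable borel"
  by (intro borel_measurable_continuous_onI continuous_intros)

lemma measurable_quadratic_form [measurable]:
  fixes A :: "real^'t^'t"
  shows "(\<lambda>\<tau>. \<tau> \<bullet> (A *v \<tau>)) \<in> borel_measurable borel"
  by (intro borel_measurable_continuous_onI continuous_intros)

text \<open>Exchangeability gives all permuted copies of the form the same integral, while their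
  pointwise sum is the trace times a multiple of \<open>\<tau> \<bullet> \<tau>\<close>. The product
  form of the identity remains meaningful for infinite integrals.\<close>

lemma exchangeable_integral_quadratic_form:
  fixes A :: "real^'t^'t" and g :: "(real^'t) measure"
  assumes card: "CARD('t) \<ge> 2" and A: "A *v 1 = 0" and nn: "\<And>\<tau>. 0 \<le> \<tau> \<bullet> (A *v \<tau>)"
    and g: "prior_distribution g" "exchangeable g"
  shows "fact CARD('t) * (\<integral>\<^sup>+ \<tau>. ennreal (\<tau> \<bullet> (A *v \<tau>)) \<partial>g)
    = ennreal (trace A) * (\<integral>\<^sup>+ \<tau>. ennreal (fact CARD('t) / (real CARD('t) - 1) * (\<tau> \<bullet> \<tau>)) \<partial>g)"
proof -
  have [measurable_cong]: "sets g = sets borel" using g by (simp add: prior_distribution_def)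
  define p where "p \<pi> \<tau> = (\<chi> i. \<tau> $ \<pi> i)" for \<pi> :: "'t \<Rightarrow> 't" and \<tau> :: "real^'t"
  have [measurable]: "p \<pi> \<in> borel_measurable borel" for \<pi>
    unfolding p_def by measurable
  define I where "I = (\<integral>\<^sup>+ \<tau>. ennreal (\<tau> \<bullet> (A *v \<tau>)) \<partial>g)"
  have I: "(\<integral>\<^sup>+ \<tau>. ennreal (p \<pi> \<tau> \<bullet> (A *v p \<pi> \<tau>)) \<partial>g) = I" if "\<pi> permutes UNIV" for \<pi>
  proof -
    have "I = (\<integral>\<^sup>+ \<tau>. ennreal (\<tau> \<bullet> (A *v \<tau>)) \<partial>distr g borel (p \<pi>))"
      using g(2) that by (simp add: I_def exchangeable_def p_def[abs_def])
    also have "\<dots> = (\<integral>\<^sup>+ \<tau>. ennreal (p \<pi> \<tau> \<bullet> (A *v p \<pi> \<tau>)) \<partial>g)"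
      by (intro nn_integral_distr) measurable
    finally show ?thesis by simp
  qed
  have "fact CARD('t) * I = (\<Sum>\<pi> | \<pi> permutes (UNIV :: 't set). I)"
    by (simp add: card_permutations[OF refl])
  also have "\<dots> = (\<Sum>\<pi> | \<pi> permutes (UNIV :: 't set). \<integral>\<^sup>+ \<tau>. ennreal (p \<pi> \<tau> \<bullet> (A *v p \<pi> \<tau>)) \<partial>g)"
    by (simp add: I)
  also have "\<dots> = (\<integral>\<^sup>+ \<tau>. (\<Sum>\<pi> | \<pi> permutes (UNIV :: 't set). ennreal (p \<pi> \<tau> \<bullet> (A *v p \<pi> \<tau>))) \<partial>g)"
    by (rule nn_integral_sum[symmetric]) measurable
  also have "\<dots> = (\<integral>\<^sup>+ \<tau>. ennreal (trace A) * ennreal (fact CARD('t) / (real CARD('t) - 1) * (\<tau> \<bullet> \<tau>)) \<partial>g)"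
  proof (rule nn_integral_cong_AE)
    \<comment> \<open>The pointwise identity holds for vectors with coordinate sum zero, which the
      prior ensures almost everywhere.\<close>
    have "AE \<tau> in g. (\<Sum>i\<in>UNIV. \<tau> $ i) = 0"
      using g(1) by (auto simp: prior_distribution_def)
    then show "AE \<tau> in g. (\<Sum>\<pi> | \<pi> permutes (UNIV :: 't set). ennreal (p \<pi> \<tau> \<bullet> (A *v p \<pi> \<tau>)))
      = ennreal (trace A) * ennreal (fact CARD('t) / (real CARD('t) - 1) * (\<tau> \<bullet> \<tau>))"
    proof eventually_elim
      case (elim \<tau>)
      have "(\<Sum>\<pi> | \<pi> permutes (UNIV :: 't set). ennreal (p \<pi> \<tau> \<bullet> (A *v p \<pi> \<tau>)))
          = ennreal (trace A * (fact CARD('t) / (real CARD('t) - 1) * (\<tau> \<bullet> \<tau>)))"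
        unfolding sum_permuted_quadratic_form[OF card A elim, symmetric] p_def
        by (intro sum_ennreal nn)
      moreover have "0 \<le> trace A"
        unfolding trace_eq_sum_inner by (intro sum_nonneg nn)
      moreover have "0 \<le> fact CARD('t) / (real CARD('t) - 1) * (\<tau> \<bullet> \<tau>)"
        using card by simp
      ultimately show ?case
        by (simp only: ennreal_mult)
    qed
  qed
  also have "\<dots> = ennreal (trace A) * (\<integral>\<^sup>+ \<tau>. ennreal (fact CARD('t) / (real CARD('t) - 1) * (\<tau> \<bullet> \<tau>)) \<partial>g)"
    by (rule nn_integral_cmult) measurable
  finally show ?thesis by (simp add: I_def)
qed

section \<open>The uniform prior on centered unit vectors\<close>

definition contrast_prior :: "(real^'t) measure" where
  "contrast_prior = distr (measure_pmf (pmf_of_set UNIV)) borel (\<lambda>i. B_mat *v axis i 1)"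

lemma B_mat_axis_nth: "((B_mat :: real^'t^'t) *v axis i 1) $ j = (if j = i then 1 else 0) - 1 / real CARD('t)"
  by (simp add: matrix_vector_mult_basis column_def B_mat_nth)

lemma prior_distribution_contrast_prior:
  assumes card: "CARD('t) \<ge> 2"
  shows "prior_distribution (contrast_prior :: (real^'t) measure)"
proof -
  \<comment> \<open>Transferring the almost-everywhere condition through \<open>distr\<close>
    requires this set to be measurable; it is a closed hyperplane without the origin.\<close>
  have "{\<tau>::real^'t. (\<Sum>i\<in>UNIV. \<tau> $ i) = 0} \<in> sets borel"
    by (intro borel_closed closed_Collect_eq continuous_intros)
  then have "{\<tau>::real^'t. (\<Sum>i\<in>UNIV. \<tau> $ i) = 0} - {0} \<in> sets borel"
    by (intro sets.Diff) auto
  also have "{\<tau>::real^'t. (\<Sum>i\<in>UNIV. \<tau> $ i) = 0} - {0} = {\<tau> \<in> space borel. (\<Sum>i\<in>UNIV. \<tau> $ i) = 0 \<and> \<tau> \<noteq> 0}"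
    by auto
  finally have meas: "{\<tau>::real^'t \<in> space borel. (\<Sum>i\<in>UNIV. \<tau> $ i) = 0 \<and> \<tau> \<noteq> 0} \<in> sets borel" .
  have "(\<Sum>j\<in>UNIV. ((B_mat :: real^'t^'t) *v axis i 1) $ j) = 0" for i
    by (simp add: B_mat_axis_nth sum_subtractf)
  moreover have "((B_mat :: real^'t^'t) *v axis i 1) \<noteq> 0" for i
    using card B_mat_axis_nth[of i i] by auto
  ultimately show ?thesis
    using meas unfolding prior_distribution_def contrast_prior_def
    by (auto simp: AE_distr_iff intro!: prob_space.prob_space_distr measure_pmf.prob_space_axioms)
qed

text \<open>Permuting the coordinates of a centered unit vector by \<open>\<pi>\<close> gives the
  one indexed by \<open>inv \<pi> i\<close>, and a bijection preserves the uniform distribution of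
  the index.\<close>

lemma exchangeable_contrast_prior: "exchangeable (contrast_prior :: (real^'t) measure)"
  unfolding exchangeable_def
proof (intro allI impI)
  fix \<pi> :: "'t \<Rightarrow> 't" assume \<pi>: "\<pi> permutes UNIV"
  define f :: "'t \<Rightarrow> real^'t" where "f i = B_mat *v axis i 1" for i
  have f: "(\<chi> j. f i $ \<pi> j) = f (inv \<pi> i)" for i
    using permutes_inverses[OF \<pi>] by (auto simp: f_def vec_eq_iff B_mat_axis_nth)
  have "distr contrast_prior borel (\<lambda>\<tau>. \<chi> j. \<tau> $ \<pi> j)
      = distr (measure_pmf (pmf_of_set UNIV)) borel (f \<circ> inv \<pi>)"
    unfolding contrast_prior_def f_def[symmetric]
    by (subst distr_distr) (auto simp: comp_def f)
  also have "\<dots> = distr (measure_pmf (map_pmf (inv \<pi>) (pmf_of_set UNIV))) borel f"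
    unfolding map_pmf_rep_eq by (subst distr_distr) auto
  also have "map_pmf (inv \<pi>) (pmf_of_set UNIV) = pmf_of_set UNIV"
    using permutes_imp_bij[OF permutes_inv[OF \<pi>]] by (intro map_pmf_of_set_bij_betw) auto
  finally show "distr contrast_prior borel (\<lambda>\<tau>. \<chi> j. \<tau> $ \<pi> j) = (contrast_prior :: (real^'t) measure)"
    by (simp add: contrast_prior_def f_def[abs_def])
qed

lemma nn_integral_contrast_prior_inner:
  "(\<integral>\<^sup>+ \<tau>. ennreal (c * (\<tau> \<bullet> \<tau>)) \<partial>(contrast_prior :: (real^'t) measure))
    = ennreal (c * (1 - 1 / real CARD('t)))"
proof -
  have "(B_mat *v axis i 1) \<bullet> (B_mat *v axis i 1) = 1 - 1 / real CARD('t)" for i :: 't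
  proof -
    have "(B_mat *v axis i 1) \<bullet> (B_mat *v axis i 1)
        = (\<Sum>j\<in>UNIV. (if j = i then 1 - 2 / real CARD('t) else 0) + 1 / (real CARD('t))\<^sup>2)"
      unfolding inner_vec_def B_mat_axis_nth
      by (intro sum.cong) (auto simp: power2_eq_square algebra_simps)
    also have "\<dots> = 1 - 1 / real CARD('t)"
      by (simp add: sum.distrib) (simp add: power2_eq_square field_simps)
    finally show ?thesis .
  qed
  then show ?thesis
    unfolding contrast_prior_def
    by (subst nn_integral_distr) auto
qed

theorem theorem11:
  fixes n :: nat
    and Cov :: "real^'p::{finite,linorder}^'p::_"
    and lam0 :: real
    and ginv :: "real^'t::finite^'t \<Rightarrow> real^'t^'t"
    and d :: "('p \<Rightarrow> 't) \<Rightarrow> real"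
  assumes "CARD('p) \<ge> 2" and "CARD('t) \<ge> 2" and "n \<ge> 1"
    and "symmetric_pos_def Cov"
    and "\<And>M. is_generalized_inverse M (ginv M)"
    and "approx_design d"
  shows "(\<forall>g. prior_distribution g \<and> exchangeable g \<longrightarrow>
            (\<forall>d'. approx_design d' \<longrightarrow>
               phi ginv n Cov g lam0 d' \<le> phi ginv n Cov g lam0 d))
         \<longleftrightarrow> trace (A_info ginv n Cov lam0 d) = real n * y0 TYPE('t) Cov lam0"
proof -
  note card = assms(2) and Cov = assms(4) and ginv = assms(5) and d = assms(6)
  define N where "N = (fact CARD('t) :: ennreal)"
  define k where "k = fact CARD('t) / (real CARD('t) - 1)"
  define tr where "tr d = trace (A_info ginv n Cov lam0 d)" for d :: "('p \<Rightarrow> 't) \<Rightarrow> real"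
  have N: "N = ennreal (fact CARD('t))"
    using ennreal_of_nat_eq_real_of_nat[of "fact CARD('t)"] by (simp add: N_def)
  have phi_le_iff: "phi ginv n Cov g lam0 d' \<le> phi ginv n Cov g lam0 d \<longleftrightarrow>
      ennreal (tr d') * (\<integral>\<^sup>+ \<tau>. ennreal (k * (\<tau> \<bullet> \<tau>)) \<partial>g) \<le> ennreal (tr d) * (\<integral>\<^sup>+ \<tau>. ennreal (k * (\<tau> \<bullet> \<tau>)) \<partial>g)"
    if g: "prior_distribution g" "exchangeable g" and d': "approx_design d'" for g d'
  proof -
    have "N * phi ginv n Cov g lam0 e = ennreal (tr e) * (\<integral>\<^sup>+ \<tau>. ennreal (k * (\<tau> \<bullet> \<tau>)) \<partial>g)"
      if "approx_design e" for e
      unfolding phi_def N_def tr_def k_def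
      by (intro exchangeable_integral_quadratic_form card A_info_one A_info_nonneg Cov that ginv g)
    \<comment> \<open>The factor \<open>N\<close> is positive and finite, so it cancels in
      \<open>ennreal\<close>.\<close>
    moreover have "N * phi ginv n Cov g lam0 d' \<le> N * phi ginv n Cov g lam0 d \<longleftrightarrow>
        phi ginv n Cov g lam0 d' \<le> phi ginv n Cov g lam0 d"
      by (rule ennreal_mult_le_mult_iff) (simp_all add: N)
    ultimately show ?thesis using d d' by simp
  qed
  show ?thesis
  proof
    assume max: "\<forall>g. prior_distribution g \<and> exchangeable g \<longrightarrow>
      (\<forall>d'. approx_design d' \<longrightarrow> phi ginv n Cov g lam0 d' \<le> phi ginv n Cov g lam0 d)"
    obtain d' :: "('p \<Rightarrow> 't) \<Rightarrow> real" where d': "approx_design d'" "tr d' = n * y0 TYPE('t) Cov lam0"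
      using trace_A_info_attains_y0[OF card Cov ginv] unfolding tr_def by blast
    define c where "c = k * (1 - 1 / real CARD('t))"
    have c: "c > 0" using card by (simp add: c_def k_def)
    \<comment> \<open>Optimality is tested against a design attaining the bound, under a prior whose
      factor \<open>c\<close> is positive and finite and hence cancels.\<close>
    have "phi ginv n Cov contrast_prior lam0 d' \<le> phi ginv n Cov contrast_prior lam0 d"
      using max prior_distribution_contrast_prior[OF card] exchangeable_contrast_prior d'(1) by blast
    then have "ennreal (tr d') * ennreal c \<le> ennreal (tr d) * ennreal c"
      using phi_le_iff[OF prior_distribution_contrast_prior[OF card] exchangeable_contrast_prior d'(1)]
      by (simp add: nn_integral_contrast_prior_inner c_def)
    then have "ennreal (tr d') \<le> ennreal (tr d)"
      using c by (simp add: mult.commute[of _ "ennreal c"] ennreal_mult_le_mult_iff)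
    \<comment> \<open>Nonnegativity turns the \<open>ennreal\<close> comparison back into one of
      reals.\<close>
    moreover have "0 \<le> tr d"
      unfolding tr_def trace_eq_sum_inner by (intro sum_nonneg A_info_nonneg Cov d ginv)
    ultimately have "tr d' \<le> tr d"
      by simp
    then show "trace (A_info ginv n Cov lam0 d) = real n * y0 TYPE('t) Cov lam0"
      using trace_A_info_le_y0[OF card Cov ginv d] d'(2) by (simp add: tr_def order.antisym)
  next
    assume "trace (A_info ginv n Cov lam0 d) = real n * y0 TYPE('t) Cov lam0"
    then have "tr d' \<le> tr d" if "approx_design d'" for d'
      using trace_A_info_le_y0[OF card Cov ginv that] by (simp add: tr_def)
    \<comment> \<open>The prior contributes the same factor to both sides, and multiplication by it
      is monotone in \<open>ennreal\<close> even when it is infinite.\<close>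
    then show "\<forall>g. prior_distribution g \<and> exchangeable g \<longrightarrow>
      (\<forall>d'. approx_design d' \<longrightarrow> phi ginv n Cov g lam0 d' \<le> phi ginv n Cov g lam0 d)"
      by (auto simp: phi_le_iff intro!: mult_right_mono ennreal_leI)
  qed
qed

end
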